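(* Let $\{X_i\}_{i\in N}$ be any instance with $N=\{1,\dots,n\}$, $X=\bigcup_{i\in N}X_i$ and nested sub-groups $N_1\subsetneq N_2\subsetneq\dots\subsetneq N_\ell=N$, where $N_l=\{1,\dots,n_l\}$ and $1<n_1<\dots<n_\ell=n$; put $N_0=\emptyset$. A rate vector $(r^{(l)}_i)_{i\in N,\,1\le l\le \ell}$ is a solution to the successive global omniscience (SGO) problem for $\{X_i\}$ if and only if it is a solution to the following multi-objective linear program: minimize $r^{(1)}_N$; subject to that, minimize $r^{(2)}_N$; and so on, up to minimizing $r^{(\ell)}_N$ subject to $r^{(1)}_N,\dots,r^{(\ell-1)}_N$ having been successively minimized; over all rate vectors satisfying $$\sum_{m=1}^{l} r^{(m)}_S\ \ge\ \Big|\bigcap_{i\in N\setminus S}\overline{X}_i\Big|\qquad \text{for all } 1\le l\le \ell \text{ and all } S\subsetneq N \text{ with } N_{l-1}\subseteq S \text{ and } N_l\not\subseteq S,$$ $$r^{(l)}_i\ge 0\quad \text{for all } i\in N,\ 1\le l\le \ell .$$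
   Context: Instance. There are $n$ users $N=\{1,\dots,n\}$ and a finite set $X$ of $k$ packets. User $i$ initially holds $X_i\subseteq X$, and $X=\bigcup_{i\in N}X_i$. All index sets $X_i$ are known to all users. Integers $1\le\ell\le n$ and $1<n_1<\dots<n_\ell=n$ are fixed, and $N_l=\{1,\dots,n_l\}$. Notation. $\overline{X}_i=X\setminus X_i$ for $i\in N$; $r^{(l)}_S=\sum_{i\in S}r^{(l)}_i$ for $S\subseteq N$. Transmission model. Each packet is partitioned into $c$ chunks of equal size, where $c\geq 1$ is arbitrary but the same for all packets; each chunk is an element of a finite field, which may be chosen as large as needed. Transmissions take place in rounds $1,2,\dots,\ell$, in this order, following a schedule fixed in advance. At each transmission one user broadcasts one (coded or uncoded) chunk, i.e. one field element that is a function of the packets the user initially holds and of the chunks broadcast previously; every user receives every broadcast chunk without error or erasure. The transmission rate $r^{(l)}_i$ of user $i$ in round $l$ is the number of chunks broadcast by user $i$ in round $l$ divided by $c$; hence rates are nonnegative rational numbers, and "rate vector" means a vector of rational numbers $(r^{(l)}_i)$. SGO requirement. In every round all users in $N$ may transmit. For each $1\le l\le\ell$, at the end of round $l$ every user $i\in N_l$ must be able to recover all packets in $X$ (global omniscience) from $X_i$ and all chunks broadcast in rounds $1,\dots,l$, for every possible value of the packets. A rate vector is achievable for SGO if for some $c$ and some finite field there is a scheme with these rates satisfying this requirement. SGO problem. A solution to the SGO problem is an achievable rate vector that minimizes $r^{(1)}_N$, then, subject to that, minimizes $r^{(2)}_N$, and so on up to $r^{(\ell)}_N$ (successive, i.e.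 lexicographic, minimization among achievable rate vectors). *)

theory Defs
  imports Complex_Main "HOL-Library.FuncSet" "HOL-Algebra.Ring"
begin

text \<open>
  Users are the numbers \<open>1, \<dots>, n\<close>, rounds are the numbers \<open>1, \<dots>, ell\<close>, and \<open>Xs i\<close> is the
  set of packets initially held by user \<open>i\<close>. A rate vector is a function \<open>r\<close> with \<open>r l i\<close> the
  rate of user \<open>i\<close> in round \<open>l\<close>; its values outside \<open>1 \<le> l \<le> ell\<close>, \<open>1 \<le> i \<le> n\<close> play no role.
\<close>

type_synonym rate_vector = "nat \<Rightarrow> nat \<Rightarrow> rat"

definition subgroup_users :: "(nat \<Rightarrow> nat) \<Rightarrow> nat \<Rightarrow> nat set" where
  "subgroup_users nn l = (if l = 0 then {} else {1..nn l})"

definition round_total :: "nat \<Rightarrow> nat \<Rightarrow> rate_vector \<Rightarrow> rat" where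
  "round_total n l r = (\<Sum>i\<in>{1..n}. r l i)"

text \<open>
  \<open>successive_min f A l\<close> is the set of those elements of \<open>A\<close> that minimize \<open>f 1\<close>, subject to
  that minimize \<open>f 2\<close>, and so on up to \<open>f l\<close>.
\<close>

primrec successive_min :: "(nat \<Rightarrow> 'r \<Rightarrow> 'v::ord) \<Rightarrow> 'r set \<Rightarrow> nat \<Rightarrow> 'r set" where
  "successive_min f A 0 = A"
| "successive_min f A (Suc l) =
     {r. is_arg_min (f (Suc l)) (\<lambda>r'. r' \<in> successive_min f A l) r}"

text \<open>
  Finite fields are taken with elements of type \<^typ>\<open>nat\<close>; up to isomorphism this covers all
  of them. The content of a set of packets assigns to each packet and each chunk index
  \<open>j < c\<close> a field element.
\<close>

type_synonym 'p content = "'p \<Rightarrow> nat \<Rightarrow> nat"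

definition contents :: "nat ring \<Rightarrow> nat \<Rightarrow> 'p set \<Rightarrow> 'p content set" where
  "contents F c A = A \<rightarrow>\<^sub>E ({..<c} \<rightarrow>\<^sub>E carrier F)"

text \<open>
  A schedule lists the transmissions in temporal order; the entry \<open>(l, i)\<close> stands for one chunk
  broadcast by user \<open>i\<close> in round \<open>l\<close>. The encoder of transmission \<open>t\<close> (counted from \<open>0\<close>) maps
  the packets held by the transmitting user and the list of the \<open>t\<close> chunks broadcast before
  to the broadcast chunk. Encoders need not be linear.
\<close>

type_synonym schedule = "(nat \<times> nat) list"
type_synonym 'p encoder = "'p content \<Rightarrow> nat list \<Rightarrow> nat"

definition valid_schedule :: "nat \<Rightarrow> nat \<Rightarrow> schedule \<Rightarrow> bool" where
  "valid_schedule n ell sch \<longleftrightarrow> set sch \<subseteq> {1..ell} \<times> {1..n} \<and> sorted (map fst sch)"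

definition valid_encoders ::
  "(nat \<Rightarrow> 'p set) \<Rightarrow> nat ring \<Rightarrow> nat \<Rightarrow> schedule \<Rightarrow> (nat \<Rightarrow> 'p encoder) \<Rightarrow> bool" where
  "valid_encoders Xs F c sch enc \<longleftrightarrow>
     (\<forall>t<length sch. \<forall>v\<in>contents F c (Xs (snd (sch ! t))). \<forall>ys.
        length ys = t \<and> set ys \<subseteq> carrier F \<longrightarrow> enc t v ys \<in> carrier F)"

primrec transcript ::
  "(nat \<Rightarrow> 'p set) \<Rightarrow> schedule \<Rightarrow> (nat \<Rightarrow> 'p encoder) \<Rightarrow> 'p content \<Rightarrow> nat \<Rightarrow> nat list" where
  "transcript Xs sch enc w 0 = []"
| "transcript Xs sch enc w (Suc t) =
     transcript Xs sch enc w t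
       @ [enc t (restrict w (Xs (snd (sch ! t)))) (transcript Xs sch enc w t)]"

text \<open>Since schedules are sorted by round, the transmissions of rounds \<open>1, \<dots>, l\<close> form a prefix.\<close>

definition transmissions_upto :: "schedule \<Rightarrow> nat \<Rightarrow> nat" where
  "transmissions_upto sch l = length (filter (\<lambda>(m, i). m \<le> l) sch)"

definition recovers_all ::
  "'p set \<Rightarrow> (nat \<Rightarrow> 'p set) \<Rightarrow> nat ring \<Rightarrow> nat \<Rightarrow> schedule \<Rightarrow> (nat \<Rightarrow> 'p encoder)
     \<Rightarrow> nat \<Rightarrow> nat \<Rightarrow> bool" where
  "recovers_all X Xs F c sch enc l i \<longleftrightarrow>
     (\<exists>dec :: 'p content \<Rightarrow> nat list \<Rightarrow> 'p content. \<forall>w\<in>contents F c X.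
        dec (restrict w (Xs i)) (transcript Xs sch enc w (transmissions_upto sch l)) = w)"

definition has_rates :: "nat \<Rightarrow> nat \<Rightarrow> nat \<Rightarrow> schedule \<Rightarrow> rate_vector \<Rightarrow> bool" where
  "has_rates n ell c sch r \<longleftrightarrow>
     (\<forall>l\<in>{1..ell}. \<forall>i\<in>{1..n}. r l i = of_nat (count_list sch (l, i)) / of_nat c)"

definition sgo_achievable ::
  "nat \<Rightarrow> nat \<Rightarrow> (nat \<Rightarrow> nat) \<Rightarrow> 'p set \<Rightarrow> (nat \<Rightarrow> 'p set) \<Rightarrow> rate_vector \<Rightarrow> bool" where
  "sgo_achievable n ell nn X Xs r \<longleftrightarrow>
     (\<exists>(c::nat) (F :: nat ring) sch (enc :: nat \<Rightarrow> 'p encoder).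
        1 \<le> c \<and> field F \<and> finite (carrier F) \<and>
        valid_schedule n ell sch \<and> valid_encoders Xs F c sch enc \<and> has_rates n ell c sch r \<and>
        (\<forall>l\<in>{1..ell}. \<forall>i\<in>subgroup_users nn l. recovers_all X Xs F c sch enc l i))"

definition sgo_solution ::
  "nat \<Rightarrow> nat \<Rightarrow> (nat \<Rightarrow> nat) \<Rightarrow> 'p set \<Rightarrow> (nat \<Rightarrow> 'p set) \<Rightarrow> rate_vector \<Rightarrow> bool" where
  "sgo_solution n ell nn X Xs r \<longleftrightarrow>
     r \<in> successive_min (round_total n) {r. sgo_achievable n ell nn X Xs r} ell"

definition lp_feasible ::
  "nat \<Rightarrow> nat \<Rightarrow> (nat \<Rightarrow> nat) \<Rightarrow> 'p set \<Rightarrow> (nat \<Rightarrow> 'p set) \<Rightarrow> rate_vector \<Rightarrow> bool" where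
  "lp_feasible n ell nn X Xs r \<longleftrightarrow>
     (\<forall>l\<in>{1..ell}. \<forall>S. S \<subset> {1..n} \<and> subgroup_users nn (l - 1) \<subseteq> S \<and> \<not> subgroup_users nn l \<subseteq> S \<longrightarrow>
        (\<Sum>m\<in>{1..l}. \<Sum>i\<in>S. r m i) \<ge> of_nat (card (\<Inter>i\<in>{1..n} - S. X - Xs i))) \<and>
     (\<forall>l\<in>{1..ell}. \<forall>i\<in>{1..n}. r l i \<ge> 0)"

definition lp_solution ::
  "nat \<Rightarrow> nat \<Rightarrow> (nat \<Rightarrow> nat) \<Rightarrow> 'p set \<Rightarrow> (nat \<Rightarrow> 'p set) \<Rightarrow> rate_vector \<Rightarrow> bool" where
  "lp_solution n ell nn X Xs r \<longleftrightarrow>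
     r \<in> successive_min (round_total n) {r. lp_feasible n ell nn X Xs r} ell"

end

theory Submission
  imports Defs "HOL-Number_Theory.Residues" "HOL-Algebra.QuotRing"
begin

text \<open>
  A rate vector is achievable exactly if it is feasible for the linear program. A scheme satisfies
  every cut constraint, because the users outside a cut \<open>S\<close> can only learn the packets that none
  of them holds from the chunks sent by \<open>S\<close>. Conversely, let every chunk be a random linear
  combination, over a large prime field, of the sender's chunks. A receiver fails only if
  some nonzero difference of two contents, supported on a packet set \<open>P\<close> unknown to that receiver,
  is annihilated by all chunks sent by users holding some packet of \<open>P\<close>. By the cut constraints
  there are at least as many of these as unknown chunks in \<open>P\<close>, so a union bound over differences
  up to scaling shows that some choice of coefficients serves all receivers in all rounds.
\<close>

section \<open>Generic linear combinations modulo a prime\<close>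

lemma residue_eqI:
  fixes a b :: int
  assumes "a \<in> {0..<p}" "b \<in> {0..<p}" "p dvd a - b"
  shows "a = b"
  using assms by (metis atLeastLessThan_iff mod_eq_dvd_iff mod_pos_pos_trivial)

text \<open>As \<open>d z\<close> is invertible modulo \<open>p\<close>, the entry
  \<open>a z\<close> is determined by the other entries of \<open>a\<close>, so forgetting it is
  injective. The factor \<open>p\<close> stands on the left to avoid an exponent
  \<open>card I - 1\<close>.\<close>

lemma card_hyperplane:
  fixes d :: "'z \<Rightarrow> int"
  assumes "finite I" "prime p" "J \<subseteq> I" "z \<in> J" "\<not> int p dvd d z"
  shows "card {a \<in> I \<rightarrow>\<^sub>E {0..<int p}. int p dvd (\<Sum>x\<in>J. a x * d x)} * p \<le> p ^ card I"
proof -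
  let ?H = "{a \<in> I \<rightarrow>\<^sub>E {0..<int p}. int p dvd (\<Sum>x\<in>J. a x * d x)}"
  let ?r = "\<lambda>a. restrict a (I - {z})"
  have fJ: "finite J" using assms(1,3) finite_subset by blast
  have zI: "z \<in> I" using assms by blast
  have "inj_on ?r ?H"
  proof (rule inj_onI)
    fix a b assume a: "a \<in> ?H" and b: "b \<in> ?H" and eq: "?r a = ?r b"
    have off: "a x = b x" if "x \<in> I" "x \<noteq> z" for x
      using fun_cong[OF eq, of x] that by simp
    have "(\<Sum>x\<in>J. a x * d x) - (\<Sum>x\<in>J. b x * d x) = (\<Sum>x\<in>J. (a x - b x) * d x)"
      by (simp add: sum_subtractf left_diff_distrib)
    also have "\<dots> = (a z - b z) * d z + (\<Sum>x\<in>J - {z}. (a x - b x) * d x)"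
      by (rule sum.remove[OF fJ assms(4)])
    also have "(\<Sum>x\<in>J - {z}. (a x - b x) * d x) = 0"
      using off assms(3) by (intro sum.neutral) auto
    finally have "(a z - b z) * d z = (\<Sum>x\<in>J. a x * d x) - (\<Sum>x\<in>J. b x * d x)"
      by simp
    moreover have "int p dvd (\<Sum>x\<in>J. a x * d x) - (\<Sum>x\<in>J. b x * d x)"
      using a b by (intro dvd_diff) auto
    ultimately have "int p dvd (a z - b z) * d z" by (simp only:)
    then have "int p dvd a z - b z"
      using assms(2,5) by (meson prime_dvd_multD prime_nat_int_transfer[THEN iffD2])
    then have "a z = b z"
      using a b zI by (intro residue_eqI[of _ "int p"]) (auto simp: PiE_iff)
    then have "a x = b x" if "x \<in> I" for x using off that by (cases "x = z") auto
    then show "a = b" using a b by (intro PiE_ext[of a I _ b]) auto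
  qed
  moreover have "?r ` ?H \<subseteq> (I - {z}) \<rightarrow>\<^sub>E {0..<int p}"
    by (intro image_subsetI) (auto simp: restrict_PiE_iff PiE_iff)
  ultimately have "card ?H \<le> card ((I - {z}) \<rightarrow>\<^sub>E {0..<int p})"
    using assms(1) by (intro card_inj_on_le) (auto intro: finite_PiE)
  also have "\<dots> = p ^ (card I - 1)"
    using assms(1) zI by (simp add: card_funcsetE)
  finally have "card ?H * p \<le> p ^ (card I - 1) * p" by simp
  also have "\<dots> = p ^ card I"
    using zI assms(1) by (metis card_gt_0_iff empty_iff power_minus_mult)
  finally show ?thesis .
qed

text \<open>The rows \<open>a t\<close> are chosen independently. By \<open>card_hyperplane\<close>
  every row in \<open>U\<close> that meets \<open>D\<close> satisfies its condition in at most a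
  share \<open>1 / p\<close> of the cases, and the last hypothesis supplies at least
  \<open>card D\<close> such rows.\<close>

lemma card_annihilating_families:
  fixes d :: "'z \<Rightarrow> int" and J :: "nat \<Rightarrow> 'z set"
  assumes "finite I" "prime p" "\<And>t. t < T \<Longrightarrow> J t \<subseteq> I" "U \<subseteq> {..<T}"
    and "\<And>z. z \<in> D \<Longrightarrow> \<not> int p dvd d z"
    and "card D \<le> card {t \<in> U. J t \<inter> D \<noteq> {}}"
  shows "card {a \<in> {..<T} \<rightarrow>\<^sub>E I \<rightarrow>\<^sub>E {0..<int p}. \<forall>t\<in>U. int p dvd (\<Sum>z\<in>J t \<inter> D. a t z * d z)}
           * p ^ card D \<le> (p ^ card I) ^ T"
proof -
  let ?G = "{t \<in> U. J t \<inter> D \<noteq> {}}"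
  \<comment> \<open>Only rows in \<open>?G\<close> are constrained: for other \<open>t\<close> in
    \<open>U\<close> the sum over \<open>J t \<inter> D\<close> is empty. The constraints on
    different rows are separate, so the families lie in a product.\<close>
  let ?H = "\<lambda>t. {v \<in> I \<rightarrow>\<^sub>E {0..<int p}. t \<in> ?G \<longrightarrow> int p dvd (\<Sum>z\<in>J t \<inter> D. v z * d z)}"
  have G: "?G \<subseteq> {..<T}" using assms(4) by blast
  have "{a \<in> {..<T} \<rightarrow>\<^sub>E I \<rightarrow>\<^sub>E {0..<int p}. \<forall>t\<in>U. int p dvd (\<Sum>z\<in>J t \<inter> D. a t z * d z)}
      \<subseteq> Pi\<^sub>E {..<T} ?H"
    by (intro subsetI PiE_I) (auto dest: PiE_mem PiE_arb)
  then have "card {a \<in> {..<T} \<rightarrow>\<^sub>E I \<rightarrow>\<^sub>E {0..<int p}. \<forall>t\<in>U. int p dvd (\<Sum>z\<in>J t \<inter> D. a t z * d z)}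
      \<le> card (Pi\<^sub>E {..<T} ?H)"
    using assms(1) by (intro card_mono) (auto intro!: finite_PiE)
  also have "\<dots> = (\<Prod>t<T. card (?H t))" by (simp add: card_PiE)
  finally have "card {a \<in> {..<T} \<rightarrow>\<^sub>E I \<rightarrow>\<^sub>E {0..<int p}. \<forall>t\<in>U. int p dvd (\<Sum>z\<in>J t \<inter> D. a t z * d z)}
      * p ^ card D \<le> (\<Prod>t<T. card (?H t)) * p ^ card ?G"
    using assms(6) prime_gt_0_nat[OF assms(2)] by (intro mult_le_mono power_increasing) auto
  \<comment> \<open>Spreading the power over all rows, with factor 1 off \<open>?G\<close>, allows
    the two products to be compared factor by factor.\<close>
  also have "p ^ card ?G = (\<Prod>t<T. if t \<in> ?G then p else 1)"
    using G by (subst prod.inter_restrict[symmetric]) (auto simp: Int_absorb1)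
  also have "(\<Prod>t<T. card (?H t)) * \<dots> = (\<Prod>t<T. card (?H t) * (if t \<in> ?G then p else 1))"
    by (simp only: prod.distrib)
  also have "\<dots> \<le> (\<Prod>t<T. p ^ card I)"
  proof (rule prod_mono, rule conjI)
    fix t assume t: "t \<in> {..<T}"
    show "card (?H t) * (if t \<in> ?G then p else 1) \<le> p ^ card I"
    proof (cases "t \<in> ?G")
      case True
      then obtain z where z: "z \<in> J t \<inter> D" by blast
      have "?H t = {v \<in> I \<rightarrow>\<^sub>E {0..<int p}. int p dvd (\<Sum>z\<in>J t \<inter> D. v z * d z)}"
        by (simp only: True simp_thms)
      moreover have Jt: "J t \<inter> D \<subseteq> I" using assms(3) t by auto
      moreover have nz: "\<not> int p dvd d z" using assms(5) z by blast
      ultimately show ?thesis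
        using card_hyperplane[where d = d, OF assms(1,2) Jt z nz] by (simp only: True if_True)
    next
      case False
      then have "?H t = I \<rightarrow>\<^sub>E {0..<int p}" by (simp only: simp_thms Collect_mem_eq)
      then show ?thesis using assms(1) by (simp only: False if_False card_funcsetE) simp
    qed
  qed simp
  finally show ?thesis by simp
qed

text \<open>
  The Hall condition makes a random family of functionals kill a given nonzero difference vector
  with support \<open>D\<close> with probability at most \<open>p ^ - card D\<close>. Only the \<open>p ^ (card D - 1)\<close> vectors
  normalised at one coordinate of \<open>D\<close> matter, so the union bound leaves a factor \<open>1 / p\<close>.
\<close>

lemma generic_coefficients:
  fixes J :: "nat \<Rightarrow> 'z set" and U :: "'q \<Rightarrow> nat set" and W :: "'q \<Rightarrow> 'z set"
  assumes I: "finite I" and Q: "finite Q" and p: "prime p"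
    and J: "\<And>t. t < T \<Longrightarrow> J t \<subseteq> I" and U: "\<And>q. q \<in> Q \<Longrightarrow> U q \<subseteq> {..<T}"
    and W: "\<And>q. q \<in> Q \<Longrightarrow> W q \<subseteq> I"
    and hall: "\<And>q D. q \<in> Q \<Longrightarrow> D \<subseteq> W q \<Longrightarrow> card D \<le> card {t \<in> U q. J t \<inter> D \<noteq> {}}"
    and large: "card Q * 2 ^ card I * card I < p"
  obtains a :: "nat \<Rightarrow> 'z \<Rightarrow> int"
    where "\<And>q d z. q \<in> Q \<Longrightarrow> (\<And>t. t \<in> U q \<Longrightarrow> int p dvd (\<Sum>x\<in>J t. a t x * d x))
      \<Longrightarrow> (\<And>x. x \<in> I - W q \<Longrightarrow> int p dvd d x) \<Longrightarrow> z \<in> I \<Longrightarrow> int p dvd d z"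
proof -
  let ?A = "{..<T} \<rightarrow>\<^sub>E I \<rightarrow>\<^sub>E {0..<int p}"
  define B where "B q D d = {a \<in> ?A. \<forall>t\<in>U q. int p dvd (\<Sum>z\<in>J t \<inter> D. a t z * d z)}"
    for q D and d :: "'z \<Rightarrow> int"
  \<comment> \<open>Vectors whose support is exactly \<open>D\<close>, scaled to have entry 1 at the
    pivot \<open>z\<close>.\<close>
  define V where "V D z = {d \<in> D \<rightarrow>\<^sub>E {1..<int p}. d z = 1}" for D and z :: 'z
  \<comment> \<open>Triples of receiver, support and pivot. Their number is bounded independently of
    \<open>p\<close>, which is what the hypothesis \<open>large\<close> exploits.\<close>
  define Ix where "Ix = (SIGMA q:Q. SIGMA D:Pow (W q). D)"
  define bad where "bad = (\<Union>(q, D, z)\<in>Ix. \<Union>d\<in>V D z. B q D d)"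
  have finW: "finite (W q)" if "q \<in> Q" for q using W[OF that] I finite_subset by blast
  have p1: "1 < p" using p prime_gt_1_nat by blast
  have finIx: "finite Ix"
    unfolding Ix_def using Q finW by (auto intro!: finite_SigmaI intro: finite_subset)
  have "Ix \<subseteq> Q \<times> Pow I \<times> I" unfolding Ix_def using W by auto
  then have "card Ix \<le> card (Q \<times> Pow I \<times> I)"
    using Q I by (intro card_mono) auto
  also have "\<dots> = card Q * 2 ^ card I * card I"
    using I by (simp add: card_cartesian_product card_Pow)
  finally have Ix: "card Ix < p" using large by simp
  have one: "card (\<Union>d\<in>V D z. B q D d) * p \<le> (p ^ card I) ^ T" if "(q, D, z) \<in> Ix" for q D z
  proof -
    have q: "q \<in> Q" and D: "D \<subseteq> W q" and z: "z \<in> D" using that unfolding Ix_def by auto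
    have fD: "finite D" using D finW[OF q] finite_subset by blast
    have "V D z \<subseteq> D \<rightarrow>\<^sub>E {1..<int p}" unfolding V_def by blast
    then have fV: "finite (V D z)" using fD by (meson finite_PiE finite_atLeastLessThan_int finite_subset)
    have "inj_on (\<lambda>d. restrict d (D - {z})) (V D z)"
    proof (rule inj_onI)
      fix d e assume d: "d \<in> V D z" and e: "e \<in> V D z"
        and eq: "restrict d (D - {z}) = restrict e (D - {z})"
      have "d x = e x" if "x \<in> D" for x
        using fun_cong[OF eq, of x] d e that unfolding V_def by (cases "x = z") auto
      then show "d = e" using d e unfolding V_def by (intro PiE_ext[of d D _ e]) auto
    qed
    moreover have "(\<lambda>d. restrict d (D - {z})) ` V D z \<subseteq> (D - {z}) \<rightarrow>\<^sub>E {0..<int p}"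
      unfolding V_def by (intro image_subsetI) (force simp: restrict_PiE_iff PiE_iff)
    ultimately have "card (V D z) \<le> card ((D - {z}) \<rightarrow>\<^sub>E {0..<int p})"
      using fD by (intro card_inj_on_le) (auto intro!: finite_PiE)
    also have "\<dots> = p ^ (card D - 1)" using fD z by (simp add: card_funcsetE)
    finally have V: "card (V D z) * p \<le> p ^ card D"
      using z fD by (metis card_gt_0_iff empty_iff mult_le_mono1 power_minus_mult)
    \<comment> \<open>Both sides carry the factor \<open>p ^ card D\<close>, so that
      \<open>card_annihilating_families\<close> applies without division; it is cancelled at the
      end.\<close>
    have "card (\<Union>d\<in>V D z. B q D d) * p * p ^ card D
        \<le> (\<Sum>d\<in>V D z. card (B q D d)) * p * p ^ card D"
      using fV by (intro mult_le_mono1 card_UN_le)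
    also have "\<dots> = (\<Sum>d\<in>V D z. card (B q D d) * p ^ card D) * p"
      by (simp only: sum_distrib_right mult.assoc mult.commute[of p])
    also have "\<dots> \<le> (\<Sum>d\<in>V D z. (p ^ card I) ^ T) * p"
    proof (intro mult_le_mono1 sum_mono)
      fix d assume d: "d \<in> V D z"
      have "\<not> int p dvd d x" if "x \<in> D" for x
      proof -
        have "d x \<in> {1..<int p}" using d that unfolding V_def by (auto simp: PiE_iff)
        then show ?thesis using zdvd_imp_le by fastforce
      qed
      then show "card (B q D d) * p ^ card D \<le> (p ^ card I) ^ T"
        unfolding B_def using q D
        by (intro card_annihilating_families[OF I p J] U hall) auto
    qed
    also have "\<dots> = (card (V D z) * p) * (p ^ card I) ^ T" by simp
    also have "\<dots> \<le> p ^ card D * (p ^ card I) ^ T" using V by (rule mult_le_mono1)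
    finally have "p ^ card D * (card (\<Union>d\<in>V D z. B q D d) * p) \<le> p ^ card D * (p ^ card I) ^ T"
      by (simp only: mult.commute)
    then show ?thesis using p1 by simp
  qed
  \<comment> \<open>Each of the fewer than \<open>p\<close> triples rules out at most a share
    \<open>1 / p\<close> of all families, so some family survives.\<close>
  have "card bad * p \<le> (\<Sum>(q, D, z)\<in>Ix. card (\<Union>d\<in>V D z. B q D d)) * p"
    unfolding bad_def case_prod_beta using finIx by (intro mult_le_mono1 card_UN_le)
  also have "\<dots> = (\<Sum>(q, D, z)\<in>Ix. card (\<Union>d\<in>V D z. B q D d) * p)"
    by (simp add: sum_distrib_right case_prod_beta)
  also have "\<dots> \<le> (\<Sum>_\<in>Ix. (p ^ card I) ^ T)"
    using one by (intro sum_mono) auto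
  also have "\<dots> = card Ix * (p ^ card I) ^ T" by simp
  also have "\<dots> < p * (p ^ card I) ^ T" using Ix p1 by simp
  finally have "card bad < (p ^ card I) ^ T" by (simp add: mult.commute)
  also have "\<dots> = card ?A" using I by (simp add: card_funcsetE)
  finally have "card bad < card ?A" .
  moreover have "finite bad"
    by (rule finite_subset[of _ ?A]) (use I in \<open>auto simp: bad_def B_def intro!: finite_PiE\<close>)
  ultimately have "\<not> ?A \<subseteq> bad" using card_mono not_less by blast
  then obtain a where aA: "a \<in> ?A" and a: "a \<notin> bad" by blast
  show thesis
  proof (rule that, rule ccontr)
    fix q d z assume q: "q \<in> Q" and van: "\<And>t. t \<in> U q \<Longrightarrow> int p dvd (\<Sum>x\<in>J t. a t x * d x)"
      and off: "\<And>x. x \<in> I - W q \<Longrightarrow> int p dvd d x" and z: "z \<in> I" and nz: "\<not> int p dvd d z"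
    \<comment> \<open>The support modulo \<open>p\<close> of a supposed counterexample. Terms
      outside \<open>D\<close> are multiples of \<open>p\<close> and drop out of the sums
      below.\<close>
    define D where "D = {x \<in> I. \<not> int p dvd d x}"
    have D: "D \<subseteq> W q" unfolding D_def using off by blast
    have zD: "z \<in> D" unfolding D_def using z nz by blast
    \<comment> \<open>Multiplication by the inverse \<open>u\<close> of \<open>d z\<close>
      normalises the counterexample at \<open>z\<close>. The result \<open>e\<close> lies in
      \<open>V D z\<close>, so the chosen family would be bad.\<close>
    have "coprime (d z) (int p)"
      using nz p by (metis coprime_commute prime_imp_coprime prime_nat_int_transfer)
    then obtain u where u: "[d z * u = 1] (mod int p)" using cong_solve_coprime_int by blast
    have pint: "prime (int p)" using p by simp
    have nu: "\<not> int p dvd u"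
    proof
      assume "int p dvd u"
      then have "int p dvd d z * u" by simp
      then have "int p dvd 1" using u cong_dvd_iff by blast
      then show False using p1 by simp
    qed
    define e where "e = (\<lambda>x\<in>D. (d x * u) mod int p)"
    have "e \<in> V D z"
    proof -
      have "e x \<in> {1..<int p}" if "x \<in> D" for x
      proof -
        have "\<not> int p dvd d x * u"
          using that nu pint unfolding D_def by (simp add: prime_dvd_mult_iff)
        then have "(d x * u) mod int p \<noteq> 0" by (simp add: dvd_eq_mod_eq_0)
        moreover have "0 \<le> (d x * u) mod int p" "(d x * u) mod int p < int p"
          using p1 by simp_all
        ultimately show ?thesis using that unfolding e_def by simp
      qed
      moreover have "e z = 1" using u zD p1 unfolding e_def by (simp add: cong_def)
      ultimately show ?thesis unfolding V_def e_def by auto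
    qed
    moreover have "a \<in> B q D e"
    proof -
      have "int p dvd (\<Sum>x\<in>J t \<inter> D. a t x * e x)" if t: "t \<in> U q" for t
      proof -
        have Jt: "J t \<subseteq> I" using J U[OF q] t by blast
        then have fJ: "finite (J t)" using I finite_subset by blast
        have "(\<Sum>x\<in>J t. a t x * d x)
            = (\<Sum>x\<in>J t \<inter> D. a t x * d x) + (\<Sum>x\<in>J t - D. a t x * d x)"
          using fJ by (metis sum.Int_Diff)
        moreover have "int p dvd (\<Sum>x\<in>J t - D. a t x * d x)"
          using Jt unfolding D_def by (intro dvd_sum) auto
        ultimately have "int p dvd (\<Sum>x\<in>J t \<inter> D. a t x * d x)"
          using van[OF t] by (simp add: dvd_add_left_iff)
        then have "int p dvd (\<Sum>x\<in>J t \<inter> D. a t x * d x) * u" by simp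
        moreover have "[(\<Sum>x\<in>J t \<inter> D. a t x * e x) = (\<Sum>x\<in>J t \<inter> D. a t x * d x) * u] (mod int p)"
          unfolding sum_distrib_right
        proof (rule cong_sum)
          fix x assume "x \<in> J t \<inter> D"
          then show "[a t x * e x = a t x * d x * u] (mod int p)"
            unfolding e_def by (simp add: cong_def mod_mult_right_eq mult.assoc)
        qed
        ultimately show ?thesis using cong_dvd_iff by blast
      qed
      then show ?thesis unfolding B_def using aA by blast
    qed
    moreover have "(q, D, z) \<in> Ix" unfolding Ix_def using q D zD by blast
    ultimately have "a \<in> bad" unfolding bad_def by blast
    then show False using a by blast
  qed
qed

section \<open>The prime field on natural numbers\<close>

definition nat_residue_ring :: "nat \<Rightarrow> nat ring" where
  "nat_residue_ring p = \<lparr>carrier = {..<p}, monoid.mult = \<lambda>a b. a * b mod p, one = 1, zero = 0,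
     add = \<lambda>a b. (a + b) mod p\<rparr>"

text \<open>The model takes field elements of type \<open>nat\<close>, so the field structure of
  \<open>residue_ring (int p)\<close> is carried over along the isomorphism
  \<open>nat\<close>.\<close>

lemma field_nat_residue_ring:
  assumes "prime p"
  shows "field (nat_residue_ring p)"
proof -
  have p1: "1 < p" using assms prime_gt_1_nat by blast
  interpret residues_prime p "residue_ring (int p)"
    using assms by unfold_locales (simp_all add: prime_gt_1_nat)
  have "nat ` {0..int p - 1} = {..<p}"
  proof -
    have "x \<in> nat ` {0..int p - 1}" if "x < p" for x
      using that by (intro image_eqI[of _ _ "int x"]) auto
    then show ?thesis by auto
  qed
  then have "nat \<in> ring_iso (residue_ring (int p)) (nat_residue_ring p)"
    using p1
    by (auto simp: ring_iso_def ring_hom_def residue_ring_def nat_residue_ring_def bij_betw_def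
        inj_on_def nat_mod_distrib nat_mult_distrib nat_add_distrib)
  \<comment> \<open>The transported field has \<open>one\<close> and \<open>zero\<close> replaced by
    their images under \<open>nat\<close>, which are again 1 and 0.\<close>
  from field.ring_iso_imp_img_field[OF is_field this] show ?thesis
    by (simp add: nat_residue_ring_def residue_ring_def)
qed

section \<open>Schedules and transcripts\<close>

lemma length_filter_mem_eq_sum_count:
  assumes "finite Z"
  shows "length (filter (\<lambda>x. x \<in> Z) xs) = (\<Sum>z\<in>Z. count_list xs z)"
proof (induction xs)
  case (Cons x xs)
  have "(\<Sum>z\<in>Z. count_list (x # xs) z) = (\<Sum>z\<in>Z. count_list xs z + (if z = x then 1 else 0))"
    by (intro sum.cong) auto
  then show ?case using Cons assms by (simp add: sum.distrib)
qed simp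

text \<open>Once an entry of a sorted schedule is beyond round \<open>l\<close>, all later ones are.
  Hence the count \<open>transmissions_upto\<close> is also the position where round
  \<open>l\<close> ends.\<close>

lemma less_transmissions_upto_iff:
  assumes "sorted (map fst sch)" "t < length sch"
  shows "t < transmissions_upto sch l \<longleftrightarrow> fst (sch ! t) \<le> l"
  using assms
proof (induction sch arbitrary: t)
  case (Cons z sch)
  show ?case
  proof (cases "fst z \<le> l")
    case True
    then show ?thesis
      using Cons by (cases t) (auto simp: transmissions_upto_def case_prod_beta)
  next
    case False
    then have "\<forall>y\<in>set (z # sch). \<not> fst y \<le> l" using Cons.prems(1) by auto
    then have "filter (\<lambda>(m, i). m \<le> l) (z # sch) = []" "\<not> fst ((z # sch) ! t) \<le> l"
      using nth_mem[OF Cons.prems(2)] by (auto simp only: filter_empty_conv case_prod_beta)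
    then show ?thesis by (simp only: transmissions_upto_def) simp
  qed
qed simp

lemma transmissions_upto_le_length: "transmissions_upto sch l \<le> length sch"
  by (simp add: transmissions_upto_def)

text \<open>This turns numbers of positions, which occur in the cut-set bound and in the code
  construction, into the counts per user and round that define rates.\<close>

lemma card_transmissions_upto:
  assumes "valid_schedule n ell sch" "finite S"
  shows "card {t. t < transmissions_upto sch l \<and> snd (sch ! t) \<in> S}
    = (\<Sum>m\<in>{1..l}. \<Sum>i\<in>S. count_list sch (m, i))"
proof -
  have sorted: "sorted (map fst sch)" and range: "set sch \<subseteq> {1..ell} \<times> {1..n}"
    using assms unfolding valid_schedule_def by auto
  have "{t. t < transmissions_upto sch l \<and> snd (sch ! t) \<in> S}
      = {t. t < length sch \<and> sch ! t \<in> {1..l} \<times> S}"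
  proof (rule Collect_cong)
    fix t
    show "t < transmissions_upto sch l \<and> snd (sch ! t) \<in> S
      \<longleftrightarrow> t < length sch \<and> sch ! t \<in> {1..l} \<times> S"
    proof (cases "t < length sch")
      case True
      \<comment> \<open>Rounds are numbered from 1, so being at most \<open>l\<close> amounts to
        lying in \<open>{1..l}\<close>.\<close>
      then have "fst (sch ! t) \<ge> 1" using range nth_mem by fastforce
      then show ?thesis
        using less_transmissions_upto_iff[OF sorted True, of l] True by (auto simp: mem_Times_iff)
    next
      case False
      then show ?thesis using transmissions_upto_le_length[of sch l] by auto
    qed
  qed
  then have "card {t. t < transmissions_upto sch l \<and> snd (sch ! t) \<in> S}
      = length (filter (\<lambda>z. z \<in> {1..l} \<times> S) sch)"
    by (simp only: length_filter_conv_card)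
  also have "\<dots> = (\<Sum>z\<in>{1..l} \<times> S. count_list sch z)"
    using assms by (intro length_filter_mem_eq_sum_count) auto
  finally show ?thesis by (simp add: sum.cartesian_product case_prod_beta)
qed

lemma ex_valid_schedule:
  obtains sch where "valid_schedule n ell sch"
    "\<And>l i. l \<in> {1..ell} \<Longrightarrow> i \<in> {1..n} \<Longrightarrow> count_list sch (l, i) = k l i"
proof -
  let ?Z = "{1..ell} \<times> {1..n}"
  \<comment> \<open>The order within a round is immaterial: any list with the right multiplicities
    will do, and sorting it by round makes it valid.\<close>
  obtain xs where xs: "mset xs = (\<Sum>(l, i)\<in>?Z. replicate_mset (k l i) (l, i))"
    using ex_mset by blast
  have count: "count_list xs z = (if z \<in> ?Z then k (fst z) (snd z) else 0)" for z
  proof -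
    have "count_list xs z = (\<Sum>y\<in>?Z. if y = z then k (fst y) (snd y) else 0)"
      unfolding count_mset[symmetric] xs count_sum
      by (intro sum.cong) auto
    then show ?thesis by (simp add: sum.delta)
  qed
  let ?sch = "sort_key fst xs"
  have count': "count_list ?sch z = count_list xs z" for z
    by (metis count_mset mset_sort)
  have "set ?sch \<subseteq> ?Z"
    using count count_list_0_iff by (metis set_sort subsetI)
  then have "valid_schedule n ell ?sch" by (simp add: valid_schedule_def)
  then show thesis using that[of ?sch] count count' by simp
qed

section \<open>Transcripts and recoverability\<close>

lemma length_transcript [simp]: "length (transcript Xs sch enc w T) = T"
  by (induction T) auto

lemma nth_transcript:
  assumes "t < T"
  shows "transcript Xs sch enc w T ! t
    = enc t (restrict w (Xs (snd (sch ! t)))) (transcript Xs sch enc w t)"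
  using assms by (induction T) (auto simp: nth_append less_Suc_eq)

lemma restrict_mem_contents:
  assumes "w \<in> contents F c X" "Y \<subseteq> X"
  shows "restrict w Y \<in> contents F c Y"
  using assms unfolding contents_def by (auto simp: restrict_PiE_iff)

lemma set_transcript_subset:
  assumes "valid_encoders Xs F c sch enc" "w \<in> contents F c X"
    "\<And>z. z \<in> set sch \<Longrightarrow> Xs (snd z) \<subseteq> X" "T \<le> length sch"
  shows "set (transcript Xs sch enc w T) \<subseteq> carrier F"
  using assms(4)
proof (induction T)
  case (Suc T)
  have "restrict w (Xs (snd (sch ! T))) \<in> contents F c (Xs (snd (sch ! T)))"
    using assms(2) assms(3)[OF nth_mem, of T] Suc.prems by (intro restrict_mem_contents) auto
  then show ?case
    using assms(1) Suc unfolding valid_encoders_def by simp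
qed simp

text \<open>A decoder is a left inverse of the map from contents to observations, so it exists
  exactly if this map is injective on \<open>contents F c X\<close>.\<close>

lemma recovers_all_iff:
  "recovers_all X Xs F c sch enc l i \<longleftrightarrow>
    (\<forall>w\<in>contents F c X. \<forall>w'\<in>contents F c X. restrict w (Xs i) = restrict w' (Xs i) \<longrightarrow>
      transcript Xs sch enc w (transmissions_upto sch l)
        = transcript Xs sch enc w' (transmissions_upto sch l) \<longrightarrow> w = w')" (is "_ \<longleftrightarrow> ?inj")
proof
  let ?obs = "\<lambda>w. (restrict w (Xs i), transcript Xs sch enc w (transmissions_upto sch l))"
  assume ?inj
  then have "inj_on ?obs (contents F c X)" by (intro inj_onI) auto
  then have "inv_into (contents F c X) ?obs (?obs w) = w" if "w \<in> contents F c X" for w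
    using that by (rule inv_into_f_f)
  then show "recovers_all X Xs F c sch enc l i"
    unfolding recovers_all_def
    by (intro exI[of _ "\<lambda>u y. inv_into (contents F c X) ?obs (u, y)"]) auto
next
  assume "recovers_all X Xs F c sch enc l i"
  then show ?inj unfolding recovers_all_def by metis
qed

lemma card_contents:
  assumes "finite A"
  shows "card (contents F c A) = card (carrier F) ^ (c * card A)"
  using assms by (simp add: contents_def card_funcsetE power_mult)

section \<open>The cut-set bound\<close>

text \<open>Induction on time: a chunk from outside \<open>S\<close> is a function of packets on
  which \<open>w\<close> and \<open>w'\<close> agree and of earlier chunks, which agree by
  induction.\<close>

lemma transcript_cong:
  assumes "\<And>t. t < T \<Longrightarrow> snd (sch ! t) \<notin> S \<Longrightarrow>
      restrict w (Xs (snd (sch ! t))) = restrict w' (Xs (snd (sch ! t)))"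
    and "\<And>t. t < T \<Longrightarrow> snd (sch ! t) \<in> S \<Longrightarrow>
      transcript Xs sch enc w T ! t = transcript Xs sch enc w' T ! t"
  shows "transcript Xs sch enc w T = transcript Xs sch enc w' T"
  using assms
proof (induction T)
  case (Suc T)
  have IH: "transcript Xs sch enc w T = transcript Xs sch enc w' T"
  proof (rule Suc.IH)
    fix t assume "t < T" "snd (sch ! t) \<in> S"
    then show "transcript Xs sch enc w T ! t = transcript Xs sch enc w' T ! t"
      using Suc.prems(2)[of t] by (simp add: nth_append)
  qed (use Suc.prems(1) in auto)
  have "enc T (restrict w (Xs (snd (sch ! T)))) (transcript Xs sch enc w T)
      = enc T (restrict w' (Xs (snd (sch ! T)))) (transcript Xs sch enc w' T)"
  proof (cases "snd (sch ! T) \<in> S")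
    case True
    then show ?thesis using Suc.prems(2)[of T] by (simp add: nth_append)
  next
    case False
    then have "restrict w (Xs (snd (sch ! T))) = restrict w' (Xs (snd (sch ! T)))"
      using Suc.prems(1)[of T] by blast
    then show ?thesis using IH by (simp only:)
  qed
  then show ?case using IH by simp
qed simp

text \<open>
  The users outside \<open>S\<close> do not hold any packet of \<open>P\<close>. Once all other packets are fixed, the
  chunks sent by \<open>S\<close> determine the whole transcript, hence the content of \<open>P\<close>.
\<close>

lemma cut_set_bound:
  assumes X: "finite X" "\<And>j. j \<in> {1..n} \<Longrightarrow> Xs j \<subseteq> X"
    and F: "field F" "finite (carrier F)"
    and sch: "valid_schedule n ell sch" "valid_encoders Xs F c sch enc"
    and rec: "recovers_all X Xs F c sch enc l i" and i: "i \<in> {1..n} - S"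
    and P: "P \<subseteq> X" "\<And>j. j \<in> {1..n} - S \<Longrightarrow> Xs j \<inter> P = {}"
  shows "c * card P \<le> card {t. t < transmissions_upto sch l \<and> snd (sch ! t) \<in> S}"
proof -
  interpret field F by fact
  define T where "T = transmissions_upto sch l"
  define G where "G = {t. t < T \<and> snd (sch ! t) \<in> S}"
  \<comment> \<open>Packets outside \<open>P\<close> are filled with zero chunks, so any two
    extensions look alike to every user outside \<open>S\<close>.\<close>
  define ext where "ext v = (\<lambda>x\<in>X. if x \<in> P then v x else (\<lambda>k\<in>{..<c}. \<zero>\<^bsub>F\<^esub>))" for v
  define h where "h v = (\<lambda>t\<in>G. transcript Xs sch enc (ext v) T ! t)" for v
  have T: "T \<le> length sch" unfolding T_def by (rule transmissions_upto_le_length)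
  have user: "snd z \<in> {1..n}" if "z \<in> set sch" for z
    using that sch(1) unfolding valid_schedule_def by auto
  have fG: "finite G" unfolding G_def by simp
  have fP: "finite P" using P(1) X(1) finite_subset by blast
  have ext: "ext v \<in> contents F c X" if "v \<in> contents F c P" for v
    using that unfolding ext_def contents_def by (auto simp: restrict_PiE_iff PiE_iff)
  have away: "restrict (ext v) (Xs j) = restrict (ext v') (Xs j)" if "j \<in> {1..n} - S" for v v' j
    using P(2)[OF that] X(2)[of j] that unfolding ext_def by (intro restrict_ext) auto
  have "inj_on h (contents F c P)"
  proof (rule inj_onI)
    fix v v' assume v: "v \<in> contents F c P" and v': "v' \<in> contents F c P" and eq: "h v = h v'"
    have "transcript Xs sch enc (ext v) T = transcript Xs sch enc (ext v') T"
    proof (rule transcript_cong)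
      fix t assume t: "t < T"
      show "restrict (ext v) (Xs (snd (sch ! t))) = restrict (ext v') (Xs (snd (sch ! t)))"
        if "snd (sch ! t) \<notin> S"
        using that t T user by (intro away) auto
      show "transcript Xs sch enc (ext v) T ! t = transcript Xs sch enc (ext v') T ! t"
        if "snd (sch ! t) \<in> S"
        using fun_cong[OF eq, of t] that t unfolding h_def G_def by simp
    qed
    then have "ext v = ext v'"
      using rec ext[OF v] ext[OF v'] away[OF i] unfolding recovers_all_iff T_def by blast
    moreover have "ext u x = u x" if "x \<in> P" for u x
      using that P(1) unfolding ext_def by auto
    ultimately have "v x = v' x" if "x \<in> P" for x using that by metis
    then show "v = v'"
      using v v' unfolding contents_def by (intro PiE_ext[of v P _ v']) auto
  qed
  moreover have "h ` contents F c P \<subseteq> G \<rightarrow>\<^sub>E carrier F"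
  proof (intro image_subsetI)
    fix v assume "v \<in> contents F c P"
    then have "set (transcript Xs sch enc (ext v) T) \<subseteq> carrier F"
      using sch(2) ext X(2) user T by (intro set_transcript_subset) auto
    then show "h v \<in> G \<rightarrow>\<^sub>E carrier F"
      unfolding h_def restrict_PiE_iff G_def
      by (metis (no_types, lifting) length_transcript mem_Collect_eq nth_mem subsetD)
  qed
  ultimately have "card (contents F c P) \<le> card (G \<rightarrow>\<^sub>E carrier F)"
    using fG F(2) by (intro card_inj_on_le) (auto intro: finite_PiE)
  then have "card (carrier F) ^ (c * card P) \<le> card (carrier F) ^ card G"
    using fP fG by (simp add: card_contents card_funcsetE)
  \<comment> \<open>A field has two distinct elements, so the base exceeds 1 and the powers can be
    compared by their exponents.\<close>
  moreover have "card {\<zero>\<^bsub>F\<^esub>, \<one>\<^bsub>F\<^esub>} \<le> card (carrier F)"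
    using F(2) by (intro card_mono) auto
  ultimately show ?thesis
    unfolding G_def T_def by simp
qed

section \<open>Achievability by linear codes\<close>

text \<open>The unknowns of \<open>generic_coefficients\<close> are pairs of a packet and a chunk
  index. A user holding a packet holds all its \<open>c\<close> chunks, so the cut condition on
  packet sets yields the Hall condition on sets of such pairs.\<close>

lemma ex_linear_code:
  assumes X: "finite X" "\<And>j. j \<in> {1..n} \<Longrightarrow> Xs j \<subseteq> X" and sch: "valid_schedule n ell sch"
    and cut: "\<And>l i P. (l, i) \<in> Q \<Longrightarrow> P \<subseteq> X - Xs i \<Longrightarrow>
      c * card P \<le> card {t. t < transmissions_upto sch l \<and> snd (sch ! t) \<in> {j \<in> {1..n}. Xs j \<inter> P \<noteq> {}}}"
    and Q: "finite Q"
  obtains F :: "nat ring" and enc where "field F" "finite (carrier F)" "valid_encoders Xs F c sch enc"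
    "\<And>l i. (l, i) \<in> Q \<Longrightarrow> recovers_all X Xs F c sch enc l i"
proof -
  define I where "I = X \<times> {..<c}"
  define J where "J t = Xs (snd (sch ! t)) \<times> {..<c}" for t
  define U where "U q = {..<transmissions_upto sch (fst q)}" for q :: "nat \<times> nat"
  define W where "W q = (X - Xs (snd q)) \<times> {..<c}" for q :: "nat \<times> nat"
  obtain p where p: "prime p" and large: "card Q * 2 ^ card I * card I < p"
    using bigger_prime by blast
  have p1: "1 < p" using p prime_gt_1_nat by blast
  have user: "snd (sch ! t) \<in> {1..n}" if "t < length sch" for t
    using that sch nth_mem unfolding valid_schedule_def by fastforce
  have I: "finite I" unfolding I_def using X(1) by simp
  have J: "J t \<subseteq> I" if "t < length sch" for t
    unfolding I_def J_def using X(2)[OF user[OF that]] by auto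
  have U: "U q \<subseteq> {..<length sch}" for q
    unfolding U_def using transmissions_upto_le_length[of sch "fst q"] by auto
  have W: "W q \<subseteq> I" for q unfolding W_def I_def by blast
  have hall: "card D \<le> card {t \<in> U q. J t \<inter> D \<noteq> {}}" if q: "q \<in> Q" and D: "D \<subseteq> W q" for q D
  proof -
    have P: "fst ` D \<subseteq> X - Xs (snd q)" using D unfolding W_def by auto
    then have fP: "finite (fst ` D)" using X(1) finite_subset by blast
    \<comment> \<open>Enlarging \<open>D\<close> to all chunks of its packets can only increase its
      size and leaves the set of transmissions that meet it unchanged.\<close>
    have DP: "D \<subseteq> fst ` D \<times> {..<c}" using D unfolding W_def by force
    then have "card D \<le> card (fst ` D \<times> {..<c})" using fP by (intro card_mono) auto
    also have "\<dots> = c * card (fst ` D)" by (simp add: card_cartesian_product mult.commute)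
    also have "\<dots> \<le> card {t. t < transmissions_upto sch (fst q)
        \<and> snd (sch ! t) \<in> {j \<in> {1..n}. Xs j \<inter> fst ` D \<noteq> {}}}"
      using q P by (intro cut[of _ "snd q"]) auto
    also have "\<dots> \<le> card {t \<in> U q. J t \<inter> D \<noteq> {}}"
    proof (rule card_mono)
      show "{t. t < transmissions_upto sch (fst q) \<and> snd (sch ! t) \<in> {j \<in> {1..n}. Xs j \<inter> fst ` D \<noteq> {}}}
          \<subseteq> {t \<in> U q. J t \<inter> D \<noteq> {}}"
        using DP unfolding U_def J_def by fastforce
    qed (simp add: U_def)
    finally show ?thesis .
  qed
  obtain a :: "nat \<Rightarrow> 'a \<times> nat \<Rightarrow> int" where a: "\<And>q d z. q \<in> Q \<Longrightarrow>
      (\<And>t. t \<in> U q \<Longrightarrow> int p dvd (\<Sum>x\<in>J t. a t x * d x)) \<Longrightarrow>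
      (\<And>x. x \<in> I - W q \<Longrightarrow> int p dvd d x) \<Longrightarrow> z \<in> I \<Longrightarrow> int p dvd d z"
    using generic_coefficients[of I Q p "length sch" J U W] I Q p J U W hall large by blast
  \<comment> \<open>The earlier chunks \<open>ys\<close> are ignored, so every chunk is a linear
    form in the sender's own packets.\<close>
  define enc where "enc t v (ys :: nat list) = nat ((\<Sum>(x, k)\<in>J t. a t (x, k) * int (v x k)) mod int p)"
    for t and v :: "'a content" and ys
  let ?F = "nat_residue_ring p"
  show thesis
  proof (rule that)
    show "field ?F" using p by (rule field_nat_residue_ring)
    show "finite (carrier ?F)" by (simp add: nat_residue_ring_def)
    show "valid_encoders Xs ?F c sch enc"
      using p1 by (simp add: valid_encoders_def enc_def nat_residue_ring_def nat_less_iff)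
    fix l i assume q: "(l, i) \<in> Q"
    show "recovers_all X Xs ?F c sch enc l i"
      unfolding recovers_all_iff
    proof (intro ballI impI)
      fix w w' assume w: "w \<in> contents ?F c X" and w': "w' \<in> contents ?F c X"
        and own: "restrict w (Xs i) = restrict w' (Xs i)"
        and trans: "transcript Xs sch enc w (transmissions_upto sch l)
          = transcript Xs sch enc w' (transmissions_upto sch l)"
      \<comment> \<open>Two contents with equal observations differ by a vector that vanishes on the
        receiver's own packets and is annihilated modulo \<open>p\<close> by all received forms. The
        choice of \<open>a\<close> forces it to be 0 modulo \<open>p\<close>; as entries lie below
        \<open>p\<close>, the contents are equal.\<close>
      define d where "d z = int (w (fst z) (snd z)) - int (w' (fst z) (snd z))" for z
      have sent: "int p dvd (\<Sum>z\<in>J t. a t z * d z)" if t: "t \<in> U (l, i)" for t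
      proof -
        have code: "transcript Xs sch enc v (transmissions_upto sch l) ! t
            = nat ((\<Sum>z\<in>J t. a t z * int (v (fst z) (snd z))) mod int p)" for v
          using t unfolding U_def
          by (auto simp: nth_transcript enc_def J_def case_prod_beta
              intro!: arg_cong[of _ _ "\<lambda>s. nat (s mod int p)"] sum.cong)
        have "(\<Sum>z\<in>J t. a t z * int (w (fst z) (snd z))) mod int p
            = (\<Sum>z\<in>J t. a t z * int (w' (fst z) (snd z))) mod int p"
          using code[of w] code[of w'] trans p1 by (simp add: nat_eq_iff)
        then have "int p dvd (\<Sum>z\<in>J t. a t z * int (w (fst z) (snd z)))
            - (\<Sum>z\<in>J t. a t z * int (w' (fst z) (snd z)))"
          by (simp only: mod_eq_dvd_iff)
        then show ?thesis
          by (simp only: d_def sum_subtractf right_diff_distrib)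
      qed
      have held: "int p dvd d z" if "z \<in> I - W (l, i)" for z
      proof -
        have "fst z \<in> Xs i" using that unfolding I_def W_def by auto
        then show ?thesis using fun_cong[OF own, of "fst z"] unfolding d_def by simp
      qed
      have "w x k = w' x k" if "x \<in> X" "k < c" for x k
      proof -
        have "int p dvd d (x, k)"
          using a[OF q sent held, of "(x, k)"] that unfolding I_def by blast
        moreover have "w x k < p" "w' x k < p"
          using w w' that unfolding contents_def nat_residue_ring_def by (auto simp: PiE_iff)
        ultimately have "int (w x k) = int (w' x k)"
          unfolding d_def by (intro residue_eqI[of _ "int p"]) auto
        then show ?thesis by simp
      qed
      moreover have "w x \<in> {..<c} \<rightarrow>\<^sub>E carrier ?F" "w' x \<in> {..<c} \<rightarrow>\<^sub>E carrier ?F" if "x \<in> X" for x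
        using w w' that unfolding contents_def by (auto dest: PiE_mem)
      ultimately have "w x = w' x" if "x \<in> X" for x
        using that by (metis PiE_ext lessThan_iff)
      then show "w = w'"
        using w w' unfolding contents_def by (intro PiE_ext[of w X _ w']) auto
    qed
  qed
qed

section \<open>Achievable rates\<close>

lemma ex_common_denominator:
  fixes f :: "'a \<Rightarrow> rat"
  assumes "finite A" "\<And>x. x \<in> A \<Longrightarrow> 0 \<le> f x"
  shows "\<exists>c\<ge>1. \<exists>k. \<forall>x\<in>A. f x = of_nat (k x) / of_nat (c :: nat)"
proof -
  define den where "den x = nat (snd (quotient_of (f x)))" for x
  define num where "num x = nat (fst (quotient_of (f x)))" for x
  have den: "0 < den x" for x
    unfolding den_def using quotient_of_denom_pos' by simp
  have quot: "f x = of_nat (num x) / of_nat (den x)" if "x \<in> A" for x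
  proof -
    obtain a b where ab: "quotient_of (f x) = (a, b)" by fastforce
    have b: "0 < b" using ab by (rule quotient_of_denom_pos)
    have f: "f x = of_int a / of_int b" using ab by (rule quotient_of_div)
    then have "0 \<le> a" using assms(2)[OF that] b by (simp add: zero_le_divide_iff)
    then show ?thesis unfolding num_def den_def ab using b f by simp
  qed
  \<comment> \<open>The product of all denominators is a common denominator with an explicit formula
    for the numerators.\<close>
  define c where "c = (\<Prod>x\<in>A. den x)"
  have "f x = of_nat (num x * (\<Prod>y\<in>A - {x}. den y)) / of_nat c" if "x \<in> A" for x
  proof -
    have "c = den x * (\<Prod>y\<in>A - {x}. den y)"
      unfolding c_def using assms(1) that by (rule prod.remove)
    moreover have "0 < (\<Prod>y\<in>A - {x}. den y)" using den by (simp add: prod_pos)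
    ultimately show ?thesis using quot[OF that] den[of x] by (simp del: of_nat_prod)
  qed
  moreover have "c \<ge> 1" unfolding c_def using den by (simp add: Suc_le_eq prod_pos)
  ultimately show ?thesis
    by (intro exI[of _ c] conjI exI[of _ "\<lambda>x. num x * (\<Prod>y\<in>A - {x}. den y)"]) auto
qed

text \<open>
  A set \<open>S\<close> violating \<open>N\<^sub>l \<subseteq> S\<close> satisfies the side conditions of the linear program for the first
  round \<open>l' \<le> l\<close> with \<open>N\<^bsub>l'\<^esub> \<not>\<subseteq> S\<close>, and that constraint is the stronger one.
\<close>

lemma lp_feasible_imp_cut:
  assumes "lp_feasible n ell nn X Xs r" "l \<in> {1..ell}" "S \<subset> {1..n}" "\<not> subgroup_users nn l \<subseteq> S"
  shows "of_nat (card (\<Inter>i\<in>{1..n} - S. X - Xs i)) \<le> (\<Sum>m\<in>{1..l}. \<Sum>i\<in>S. r m i)"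
proof -
  define l' where "l' = (LEAST m. \<not> subgroup_users nn m \<subseteq> S)"
  have l': "\<not> subgroup_users nn l' \<subseteq> S" "l' \<le> l"
    unfolding l'_def using assms(4) by (rule LeastI, intro Least_le)
  \<comment> \<open>\<open>subgroup_users nn 0\<close> is empty, so \<open>l'\<close> is a genuine
    round, and its minimality gives the inclusion for \<open>l' - 1\<close>.\<close>
  have "l' \<noteq> 0" using l'(1) by (auto simp: subgroup_users_def)
  then have "l' - 1 < l'" by simp
  then have "subgroup_users nn (l' - 1) \<subseteq> S" unfolding l'_def using not_less_Least by blast
  then have "of_nat (card (\<Inter>i\<in>{1..n} - S. X - Xs i)) \<le> (\<Sum>m\<in>{1..l'}. \<Sum>i\<in>S. r m i)"
    using assms(1-3) l' \<open>l' \<noteq> 0\<close> unfolding lp_feasible_def by auto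
  also have "\<dots> \<le> (\<Sum>m\<in>{1..l}. \<Sum>i\<in>S. r m i)"
    using assms(1-3) l'(2) unfolding lp_feasible_def
    by (intro sum_mono2) (auto intro!: sum_nonneg)
  finally show ?thesis .
qed

lemma sum_rates_eq:
  assumes "has_rates n ell c sch r" "valid_schedule n ell sch" "l \<le> ell" "S \<subseteq> {1..n}"
  shows "(\<Sum>m\<in>{1..l}. \<Sum>i\<in>S. r m i)
    = of_nat (card {t. t < transmissions_upto sch l \<and> snd (sch ! t) \<in> S}) / of_nat c"
proof -
  have "(\<Sum>m\<in>{1..l}. \<Sum>i\<in>S. r m i)
      = (\<Sum>m\<in>{1..l}. \<Sum>i\<in>S. of_nat (count_list sch (m, i)) / of_nat c)"
    using assms unfolding has_rates_def by (intro sum.cong) auto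
  moreover have "finite S" using assms(4) finite_subset by blast
  ultimately show ?thesis
    using card_transmissions_upto[OF assms(2), of S l] by (simp add: sum_divide_distrib)
qed

text \<open>Necessity is \<open>cut_set_bound\<close> divided by \<open>c\<close>. For sufficiency,
  a common denominator of the rates serves as number of chunks, and \<open>ex_linear_code\<close>
  applies to any schedule with these rates.\<close>

lemma sgo_achievable_iff_lp_feasible:
  fixes r :: rate_vector
  assumes X: "finite X" "\<And>i. i \<in> {1..n} \<Longrightarrow> Xs i \<subseteq> X"
    and N: "\<And>l. l \<in> {1..ell} \<Longrightarrow> subgroup_users nn l \<subseteq> {1..n}"
  shows "sgo_achievable n ell nn X Xs r \<longleftrightarrow> lp_feasible n ell nn X Xs r"
proof
  assume "sgo_achievable n ell nn X Xs r"
  then obtain c and F :: "nat ring" and sch enc where c: "1 \<le> c"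
    and F: "field F" "finite (carrier F)"
    and sch: "valid_schedule n ell sch" "valid_encoders Xs F c sch enc"
    and rates: "has_rates n ell c sch r"
    and rec: "\<And>l i. l \<in> {1..ell} \<Longrightarrow> i \<in> subgroup_users nn l \<Longrightarrow> recovers_all X Xs F c sch enc l i"
    unfolding sgo_achievable_def by blast
  have "of_nat (card (\<Inter>i\<in>{1..n} - S. X - Xs i)) \<le> (\<Sum>m\<in>{1..l}. \<Sum>i\<in>S. r m i)"
    if l: "l \<in> {1..ell}" and S: "S \<subset> {1..n}" and cut: "\<not> subgroup_users nn l \<subseteq> S" for l S
  proof -
    let ?P = "\<Inter>i\<in>{1..n} - S. X - Xs i"
    \<comment> \<open>A user outside \<open>S\<close> who must know everything after round
      \<open>l\<close> is all that the cut-set bound requires, so the constraint follows even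
      without the side condition on \<open>l - 1\<close>.\<close>
    obtain i where i: "i \<in> subgroup_users nn l" "i \<in> {1..n} - S" using cut N[OF l] by blast
    have "c * card ?P \<le> card {t. t < transmissions_upto sch l \<and> snd (sch ! t) \<in> S}"
      using X F sch rec[OF l i(1)] i(2) by (rule cut_set_bound) (use i(2) in auto)
    then have "of_nat (c * card ?P)
        \<le> (of_nat (card {t. t < transmissions_upto sch l \<and> snd (sch ! t) \<in> S}) :: rat)"
      by (simp only: of_nat_le_iff)
    then show ?thesis
      using sum_rates_eq[OF rates sch(1), of l S] l S c
      by (simp add: pos_le_divide_eq mult.commute psubset_imp_subset)
  qed
  moreover have "0 \<le> r l i" if "l \<in> {1..ell}" "i \<in> {1..n}" for l i
    using rates that unfolding has_rates_def by simp
  ultimately show "lp_feasible n ell nn X Xs r" unfolding lp_feasible_def by blast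
next
  assume feas: "lp_feasible n ell nn X Xs r"
  then have nonneg: "0 \<le> r l i" if "l \<in> {1..ell}" "i \<in> {1..n}" for l i
    using that unfolding lp_feasible_def by blast
  obtain c k where c: "1 \<le> c"
    and k: "\<And>z. z \<in> {1..ell} \<times> {1..n} \<Longrightarrow> r (fst z) (snd z) = of_nat (k z) / of_nat (c :: nat)"
    using ex_common_denominator[of "{1..ell} \<times> {1..n}" "\<lambda>z. r (fst z) (snd z)"] nonneg
    by (auto simp: mem_Times_iff)
  obtain sch where sch: "valid_schedule n ell sch"
    and count: "\<And>l i. l \<in> {1..ell} \<Longrightarrow> i \<in> {1..n} \<Longrightarrow> count_list sch (l, i) = k (l, i)"
    using ex_valid_schedule[of n ell "\<lambda>l i. k (l, i)"] by blast
  have rates: "has_rates n ell c sch r"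
    unfolding has_rates_def using k count by fastforce
  define Q where "Q = (SIGMA l:{1..ell}. subgroup_users nn l)"
  have Q: "finite Q"
    unfolding Q_def by (auto simp: subgroup_users_def)
  have cut: "c * card P \<le> card {t. t < transmissions_upto sch l \<and> snd (sch ! t) \<in> {j \<in> {1..n}. Xs j \<inter> P \<noteq> {}}}"
    if q: "(l, i) \<in> Q" and P: "P \<subseteq> X - Xs i" for l i P
  proof -
    \<comment> \<open>No user outside \<open>?S\<close> holds a packet of \<open>P\<close>, hence
      \<open>P \<subseteq> ?P\<close>. The receiver \<open>i\<close> itself lies outside
      \<open>?S\<close>, so \<open>?S\<close> is a proper subset of the users that does not contain
      the sub-group of round \<open>l\<close>.\<close>
    let ?S = "{j \<in> {1..n}. Xs j \<inter> P \<noteq> {}}"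
    let ?P = "\<Inter>j\<in>{1..n} - ?S. X - Xs j"
    have l: "l \<in> {1..ell}" and il: "i \<in> subgroup_users nn l" using q unfolding Q_def by auto
    have i: "i \<in> {1..n} - ?S" using N[OF l] il P by auto
    have "?P \<subseteq> X" using i by blast
    then have "finite ?P" using X(1) finite_subset by blast
    moreover have "P \<subseteq> ?P" using P by auto
    ultimately have "card P \<le> card ?P" by (intro card_mono)
    then have "(of_nat (card P) :: rat) \<le> of_nat (card ?P)" by (simp only: of_nat_le_iff)
    also have "\<dots> \<le> (\<Sum>m\<in>{1..l}. \<Sum>i\<in>?S. r m i)"
      using i il by (intro lp_feasible_imp_cut[OF feas l]) auto
    also have "\<dots> = of_nat (card {t. t < transmissions_upto sch l \<and> snd (sch ! t) \<in> ?S}) / of_nat c"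
      using rates sch by (rule sum_rates_eq) (use l in auto)
    finally have "of_nat (card P) * (of_nat c :: rat)
        \<le> of_nat (card {t. t < transmissions_upto sch l \<and> snd (sch ! t) \<in> ?S})"
      by (rule pos_le_divide_eq[THEN iffD1, rotated]) (use c in simp)
    then have "rat_of_nat (card P * c)
        \<le> of_nat (card {t. t < transmissions_upto sch l \<and> snd (sch ! t) \<in> ?S})"
      by (simp only: of_nat_mult)
    then show ?thesis by (simp only: of_nat_le_iff mult.commute[of c])
  qed
  show "sgo_achievable n ell nn X Xs r"
  proof (rule ex_linear_code[OF X sch cut Q])
    fix F :: "nat ring" and enc
    assume "field F" "finite (carrier F)" "valid_encoders Xs F c sch enc"
      and "\<And>l i. (l, i) \<in> Q \<Longrightarrow> recovers_all X Xs F c sch enc l i"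
    then show ?thesis
      unfolding sgo_achievable_def using c sch rates
      by (intro exI[of _ c] exI[of _ F] exI[of _ sch] exI[of _ enc]) (auto simp: Q_def)
  qed
qed

theorem theorem2:
  fixes n ell :: nat and nn :: "nat \<Rightarrow> nat"
    and X :: "'p set" and Xs :: "nat \<Rightarrow> 'p set" and r :: rate_vector
  assumes "finite X"
    and "X = (\<Union>i\<in>{1..n}. Xs i)"
    and "1 \<le> ell" and "ell \<le> n"
    and "1 < nn 1"
    and "\<forall>l\<in>{1..<ell}. nn l < nn (Suc l)"
    and "nn ell = n"
  shows "sgo_solution n ell nn X Xs r \<longleftrightarrow> lp_solution n ell nn X Xs r"
proof -
  \<comment> \<open>Downward induction from \<open>nn ell = n\<close>, to place every sub-group
    inside \<open>{1..n}\<close>.\<close>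
  have "nn l \<le> n" if "1 \<le> l" "l \<le> ell" for l
    using that(2,1)
  proof (induction l rule: inc_induct)
    case base
    then show ?case using assms(7) by simp
  next
    case (step l)
    then have "nn l < nn (Suc l)" using assms(6) by simp
    then show ?case using step by simp
  qed
  \<comment> \<open>Both problems minimise the same objectives, so equality of the two feasible sets
    suffices and \<open>successive_min\<close> need not be unfolded.\<close>
  then have "{r. sgo_achievable n ell nn X Xs r} = {r. lp_feasible n ell nn X Xs r}"
    using assms(1,2)
    by (intro Collect_cong sgo_achievable_iff_lp_feasible) (auto simp: subgroup_users_def)
  then show ?thesis unfolding sgo_solution_def lp_solution_def by (simp only:)
qed

end
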